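(* Let $d=3$. There is an $\epsilon>0$ such that for each $N>0$ there is a finite $3$-adic step function $F:\mathbb{R}_0^+\to\mathbb{C}$ with $L^2$ norm $1$ such that $$\big|\{k: M(F)(k)>N\}\big|>\epsilon ,$$ where $$M(F)(k)=\sup_x\left|\int_{t_1<t_2<x}F(t_1)w(k,t_1)\overline{F(t_2)w(k,t_2)}\,dt_1dt_2\right| .$$
   Context: All variables $k,x,t_1,t_2$ are nonnegative reals, and $|\cdot|$ of a set is Lebesgue measure. With $d=3$: write base $d$ expansions $k=\sum_{n\in\mathbb{Z}}k_nd^n$, $x=\sum_{n\in\mathbb{Z}}x_nd^n$ with digits in $\{0,\dots,d-1\}$ vanishing for all sufficiently large positive $n$, made unique by choosing an expansion with only finitely many nonzero digits whenever possible. Let $\gamma\in\mathbb{C}$ be a fixed primitive $d$-th root of unity and $w(k,x)=\gamma^{\sum_{n\in\mathbb{Z}}k_nx_{-1-n}}$. A $d$-adic interval is an interval $[d^\kappa n,d^\kappa(n+1))$ with integers $\kappa$ and $n\ge0$; a finite $d$-adic step function is a finite linear combination (with complex coefficients) of characteristic functions of $d$-adic intervals. *)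

theory Defs
  imports "HOL-Analysis.Analysis"
begin

subsection \<open>Base d expansions\<close>

definition is_expansion :: "nat \<Rightarrow> real \<Rightarrow> (int \<Rightarrow> nat) \<Rightarrow> bool" where
  "is_expansion d x a \<longleftrightarrow>
     (\<forall>n. a n < d) \<and> (\<exists>m. \<forall>n>m. a n = 0) \<and>
     ((\<lambda>n. real (a n) * real d powi n) has_sum x) UNIV"

text \<open>The convention that makes expansions unique: finitely many nonzero digits whenever possible.\<close>

definition is_canonical_expansion :: "nat \<Rightarrow> real \<Rightarrow> (int \<Rightarrow> nat) \<Rightarrow> bool" where
  "is_canonical_expansion d x a \<longleftrightarrow> is_expansion d x a \<and>
     ((\<exists>b. is_expansion d x b \<and> finite {n. b n \<noteq> 0}) \<longrightarrow> finite {n. a n \<noteq> 0})"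

text \<open>Meaningful for \<open>d \<ge> 2\<close> and \<open>x \<ge> 0\<close>; see \<open>ex1_canonical_expansion\<close> below.\<close>

definition digits :: "nat \<Rightarrow> real \<Rightarrow> int \<Rightarrow> nat" where
  "digits d x = (THE a. is_canonical_expansion d x a)"


subsection \<open>Walsh functions, step functions and the maximal function\<close>

definition primitive_root_of_unity :: "nat \<Rightarrow> complex \<Rightarrow> bool" where
  "primitive_root_of_unity d z \<longleftrightarrow> z ^ d = 1 \<and> (\<forall>j. 0 < j \<and> j < d \<longrightarrow> z ^ j \<noteq> 1)"

text \<open>The sum over all integers has finite support (\<open>finite_walsh_support\<close> below), so it is
  written as the sum over its support.\<close>

definition walsh :: "nat \<Rightarrow> complex \<Rightarrow> real \<Rightarrow> real \<Rightarrow> complex" where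
  "walsh d \<gamma> k x =
     \<gamma> ^ (\<Sum>n | digits d k n * digits d x (- 1 - n) \<noteq> 0. digits d k n * digits d x (- 1 - n))"

definition adic_interval :: "nat \<Rightarrow> real set \<Rightarrow> bool" where
  "adic_interval d I \<longleftrightarrow>
     (\<exists>(\<kappa>::int) (n::nat). I = {real d powi \<kappa> * real n ..< real d powi \<kappa> * (real n + 1)})"

text \<open>Functions on the nonnegative reals are functions on \<open>real\<close> of which only the values on
  \<open>{0..}\<close> are used; step functions vanish on the negative reals anyway.\<close>

definition adic_step_function :: "nat \<Rightarrow> (real \<Rightarrow> complex) \<Rightarrow> bool" where
  "adic_step_function d F \<longleftrightarrow>
     (\<exists>\<I> c. finite \<I> \<and> (\<forall>I\<in>\<I>. adic_interval d I) \<and>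
       F = (\<lambda>x. \<Sum>I\<in>\<I>. c I * indicator I x))"

definition L2_norm_nonneg :: "(real \<Rightarrow> complex) \<Rightarrow> real" where
  "L2_norm_nonneg F = sqrt (LINT x:{0..}|lborel. (cmod (F x))\<^sup>2)"

text \<open>The supremum is taken in the extended reals, so that no boundedness is presupposed.\<close>

definition maximal_fn :: "nat \<Rightarrow> complex \<Rightarrow> (real \<Rightarrow> complex) \<Rightarrow> real \<Rightarrow> ereal" where
  "maximal_fn d \<gamma> F k =
     (SUP x\<in>{0..}. ereal (cmod
        (LINT t:{(t1, t2). 0 \<le> t1 \<and> t1 < t2 \<and> t2 < x}|lborel \<Otimes>\<^sub>M lborel.
           F (fst t) * walsh d \<gamma> k (fst t) * cnj (F (snd t) * walsh d \<gamma> k (snd t)))))"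


subsection \<open>Existence and uniqueness of the canonical expansion\<close>

lemma floor_step:
  fixes x :: real
  assumes "d \<ge> (2::nat)"
  shows "of_int \<lfloor>x / real d powi n\<rfloor> * real d powi n - of_int \<lfloor>x / real d powi (n + 1)\<rfloor> * real d powi (n + 1)
     = real (nat (\<lfloor>x / real d powi n\<rfloor> mod int d)) * real d powi n"
proof -
  let ?y = "x / real d powi n"
  have d: "real d \<noteq> 0" using assms by simp
  have p: "real d powi (n + 1) = real d powi n * real d" using d by (simp add: power_int_add_1)
  have "\<lfloor>x / real d powi (n + 1)\<rfloor> = \<lfloor>?y / real_of_int (int d)\<rfloor>" by (simp add: p)
  also have "\<dots> = \<lfloor>?y\<rfloor> div int d" by (rule floor_divide_real_eq_div) simp
  finally have q: "\<lfloor>x / real d powi (n + 1)\<rfloor> = \<lfloor>?y\<rfloor> div int d" .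
  have "real (nat (\<lfloor>?y\<rfloor> mod int d)) = real_of_int (\<lfloor>?y\<rfloor> mod int d)"
    using assms by (subst of_nat_nat) auto
  also have "\<dots> = real_of_int \<lfloor>?y\<rfloor> - real d * real_of_int (\<lfloor>?y\<rfloor> div int d)"
    by (simp flip: minus_mult_div_eq_mod)
  finally have "real (nat (\<lfloor>?y\<rfloor> mod int d)) * real d powi n
      = (real_of_int \<lfloor>?y\<rfloor> - real d * real_of_int (\<lfloor>?y\<rfloor> div int d)) * real d powi n" by (rule arg_cong)
  then show ?thesis unfolding q by (simp only: p left_diff_distrib right_diff_distrib mult_ac)
qed

lemma sum_telescope_int:
  fixes g :: "int \<Rightarrow> real"
  assumes "a \<le> b"
  shows "(\<Sum>n\<in>{a..<b}. g n - g (n + 1)) = g a - g b"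
  using assms
proof (induction b rule: int_ge_induct)
  case base
  then show ?case by simp
next
  case (step i)
  then have "{a..<i + 1} = insert i {a..<i}" by auto
  with step show ?case by simp
qed

lemma powi_small:
  assumes "d \<ge> (2::nat)" "e > 0"
  obtains m :: nat where "real d powi (- int m) < e"
proof -
  have "1 / real d < 1" "0 \<le> 1 / real d" using assms by auto
  then obtain m where "(1 / real d) ^ m < e" using real_arch_pow_inv[OF assms(2)] by blast
  then show ?thesis using that[of m] by (simp add: power_int_minus power_one_over inverse_eq_divide)
qed

lemma powi_large:
  assumes "d \<ge> (2::nat)"
  obtains m :: nat where "x < real d powi int m"
  using real_arch_pow[of "real d" x] assms by auto

lemma finite_int_interval:
  fixes A :: "int set"
  assumes "finite A"
  obtains a b where "a \<le> a0" "b0 \<le> b" "a \<le> b" "A \<subseteq> {a..<b}"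
proof -
  have "finite (insert a0 (insert (b0 - 1) A))" using assms by simp
  then obtain l u where "\<And>z. z \<in> insert a0 (insert (b0 - 1) A) \<Longrightarrow> l \<le> z \<and> z \<le> u"
    by (metis Max_ge Min_le)
  then show ?thesis using that[of l "u + 1"] by fastforce
qed

lemma is_expansion_floor:
  assumes d: "d \<ge> (2::nat)" and x: "x \<ge> 0"
  shows "is_expansion d x (\<lambda>n. nat (\<lfloor>x / real d powi n\<rfloor> mod int d))"
proof -
  define D where "D = (\<lambda>n. nat (\<lfloor>x / real d powi n\<rfloor> mod int d))"
  define g where "g = (\<lambda>n. of_int \<lfloor>x / real d powi n\<rfloor> * real d powi n)"
  have pos: "real d powi n > 0" for n using d by simp
  have step: "g n - g (n + 1) = real (D n) * real d powi n" for n
    unfolding g_def D_def by (rule floor_step[OF d])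
  have gle: "g n \<le> x" for n
    using of_int_floor_le[of "x / real d powi n"] unfolding g_def pos_le_divide_eq[OF pos] .
  have gge: "g n \<ge> x - real d powi n" for n
  proof -
    have "x / real d powi n \<le> real_of_int \<lfloor>x / real d powi n\<rfloor> + 1" by linarith
    then show ?thesis using pos[of n] unfolding g_def by (simp add: field_simps)
  qed
  have g0: "g n \<ge> 0" for n using pos[of n] x unfolding g_def by simp
  obtain M0 :: nat where M0: "x < real d powi int M0" using powi_large[OF d] .
  have fl0: "\<lfloor>x / real d powi n\<rfloor> = 0" if "n \<ge> int M0" for n
  proof -
    have "real d powi int M0 \<le> real d powi n" using that d by (intro power_int_increasing) auto
    then show ?thesis using M0 pos[of n] x by (simp add: floor_eq_iff)
  qed
  have g_eq0: "g n = 0" if "n \<ge> int M0" for n using fl0[OF that] by (simp add: g_def)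
  have psum: "(\<Sum>n\<in>{a..<b}. real (D n) * real d powi n) = g a - g b" if "a \<le> b" for a b
    unfolding step[symmetric] by (rule sum_telescope_int[OF that])
  have bound: "(\<Sum>n\<in>A. real (D n) * real d powi n) \<le> x" if A: "finite A" for A
  proof -
    obtain a b where "a \<le> b" "A \<subseteq> {a..<b}" using finite_int_interval[OF A] by metis
    then have "(\<Sum>n\<in>A. real (D n) * real d powi n) \<le> (\<Sum>n\<in>{a..<b}. real (D n) * real d powi n)"
      by (intro sum_mono2) (use d in auto)
    also have "\<dots> \<le> x" using psum[OF \<open>a \<le> b\<close>] gle[of a] g0[of b] by simp
    finally show ?thesis .
  qed
  have "(\<lambda>n. real (D n) * real d powi n) summable_on UNIV"
    by (rule nonneg_bdd_above_summable_on) (use d bound in \<open>auto simp: bdd_above_def\<close>)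
  then obtain S where S: "((\<lambda>n. real (D n) * real d powi n) has_sum S) UNIV"
    by (auto simp: summable_on_def)
  have "S \<le> x" using has_sum_le_finite_sums[OF S] bound by auto
  moreover have "x \<le> S"
  proof (rule field_le_epsilon)
    fix e :: real assume "e > 0"
    obtain m where m: "real d powi (- int m) < e" using powi_small[OF d \<open>e > 0\<close>] .
    have "g (- int m) = (\<Sum>n\<in>{- int m..<int M0}. real (D n) * real d powi n)"
      by (subst psum) (auto simp: g_eq0)
    also have "\<dots> \<le> S" by (rule finite_sum_le_has_sum[OF S]) (use d in auto)
    finally show "x \<le> S + e" using gge[of "- int m"] m by linarith
  qed
  ultimately have "S = x" by simp
  moreover have "D n < d" for n unfolding D_def using d by (simp add: nat_less_iff)
  moreover have "\<forall>n>int M0. D n = 0" unfolding D_def using fl0 by simp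
  ultimately show ?thesis using S unfolding is_expansion_def D_def by blast
qed

lemma canonical_expansion_floor:
  assumes d: "d \<ge> (2::nat)" and x: "x \<ge> 0" and can: "is_canonical_expansion d x a"
  shows "a n = nat (\<lfloor>x / real d powi n\<rfloor> mod int d)"
proof -
  define f where "f = (\<lambda>n. real (a n) * real d powi n)"
  have pos: "real d powi n > 0" for n using d by simp
  have exp: "is_expansion d x a" using can by (simp add: is_canonical_expansion_def)
  have lt: "a j < d" for j using exp by (simp add: is_expansion_def)
  obtain m where m: "\<And>j. j > m \<Longrightarrow> a j = 0" using exp by (auto simp: is_expansion_def)
  have sum: "(f has_sum x) UNIV" using exp unfolding is_expansion_def f_def by blast
  have fnn: "f j \<ge> 0" for j unfolding f_def using d by simp
  define b where "b = max (m + 1) (n + 1)"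
  have head: "(f has_sum (\<Sum>j\<in>{n..<b}. f j)) {n..}"
    by (rule has_sum_finite_neutralI) (auto simp: f_def b_def intro!: m)
  have sm: "f summable_on {..<n}"
    using sum by (meson summable_on_def summable_on_subset_banach subset_UNIV)
  then obtain T where T: "(f has_sum T) {..<n}" by (auto simp: summable_on_def)
  have "(f has_sum ((\<Sum>j\<in>{n..<b}. f j) + T)) ({n..} \<union> {..<n})"
    by (rule has_sum_Un_disjoint[OF head T]) auto
  moreover have "{n..} \<union> {..<n} = (UNIV :: int set)" by auto
  ultimately have xT: "x = (\<Sum>j\<in>{n..<b}. f j) + T" using sum has_sum_unique by metis
  define K where "K = (\<Sum>j\<in>{n..<b}. a j * d ^ nat (j - n))"
  have powd: "real d powi j = real (d ^ nat (j - i)) * real d powi i" if "j \<ge> i" for i j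
  proof -
    have "real d powi j = real d powi ((j - i) + i)" by simp
    also have "\<dots> = real d powi (j - i) * real d powi i" by (rule power_int_add) (use d in simp)
    finally show ?thesis using that by (simp add: power_int_nonneg_exp)
  qed
  have K: "(\<Sum>j\<in>{n..<b}. f j) = real K * real d powi n"
    unfolding K_def f_def of_nat_sum sum_distrib_right
  proof (rule sum.cong)
    fix j assume "j \<in> {n..<b}"
    then have "real d powi j = real (d ^ nat (j - n)) * real d powi n" using powd[of n j] by simp
    then show "real (a j) * real d powi j = real (a j * d ^ nat (j - n)) * real d powi n"
      by (metis mult.assoc of_nat_mult)
  qed simp
  have Kmod: "K mod d = a n"
  proof -
    have "{n..<b} = insert n {n + 1..<b}" unfolding b_def by auto
    then have "K = a n + (\<Sum>j\<in>{n + 1..<b}. a j * d ^ nat (j - n))" unfolding K_def by simp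
    moreover have "d dvd (\<Sum>j\<in>{n + 1..<b}. a j * d ^ nat (j - n))"
      by (rule dvd_sum) (auto intro!: dvd_mult dvd_power)
    ultimately show ?thesis using lt[of n] by auto
  qed
  have full: "(\<Sum>j\<in>{l..<n}. real (d - 1) * real d powi j) = real d powi n - real d powi l"
    if "l \<le> n" for l
  proof -
    have "real (d - 1) * real d powi j = - (real d powi j) - - (real d powi (j + 1))" for j
      using d by (simp add: power_int_add_1 of_nat_diff left_diff_distrib)
    then show ?thesis using sum_telescope_int[OF that, of "\<lambda>j. - (real d powi j)"] by simp
  qed
  have T0: "T \<ge> 0" by (rule has_sum_nonneg[OF T]) (simp add: fnn)
  have "\<exists>j0<n. a j0 \<noteq> d - 1"
  proof (rule ccontr)
    assume "\<not> ?thesis"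
    then have all: "\<And>j. j < n \<Longrightarrow> a j = d - 1" by auto
    have ub: "(\<Sum>j\<in>A. f j) \<le> real d powi n" if A: "finite A" "A \<subseteq> {..<n}" for A
    proof -
      obtain l u where l: "l \<le> n" "A \<subseteq> {l..<u}" using finite_int_interval[OF A(1)] by metis
      then have "A \<subseteq> {l..<n}" using A by fastforce
      then have "(\<Sum>j\<in>A. f j) \<le> (\<Sum>j\<in>{l..<n}. f j)" by (intro sum_mono2) (auto simp: fnn)
      also have "\<dots> = (\<Sum>j\<in>{l..<n}. real (d - 1) * real d powi j)"
        by (rule sum.cong) (auto simp: f_def all)
      also have "\<dots> \<le> real d powi n" using full[OF l(1)] pos[of l] by simp
      finally show ?thesis .
    qed
    have "T \<le> real d powi n" by (rule has_sum_le_finite_sums[OF T]) (rule ub)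
    moreover have "real d powi n \<le> T"
    proof (rule field_le_epsilon)
      fix e :: real assume "e > 0"
      obtain k where k: "real d powi (- int k) < e" using powi_small[OF d \<open>e > 0\<close>] .
      define l where "l = min n (- int k)"
      have "real d powi l \<le> real d powi (- int k)"
        unfolding l_def using d by (intro power_int_increasing) auto
      moreover have "real d powi n - real d powi l \<le> T"
      proof -
        have "real d powi n - real d powi l = (\<Sum>j\<in>{l..<n}. real (d - 1) * real d powi j)"
          by (rule full[symmetric]) (simp add: l_def)
        also have "\<dots> = (\<Sum>j\<in>{l..<n}. f j)"
          by (rule sum.cong) (auto simp: f_def all)
        also have "\<dots> \<le> T" by (rule finite_sum_le_has_sum[OF T]) (auto simp: fnn)
        finally show ?thesis .
      qed
      ultimately show "real d powi n \<le> T + e" using k by linarith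
    qed
    ultimately have xK: "x = real (K + 1) * real d powi n"
      using xT K by (simp add: algebra_simps)
    have z: "nat (\<lfloor>x / real d powi j\<rfloor> mod int d) = 0" if j: "j < n" for j
    proof -
      have "x = real ((K + 1) * d ^ nat (n - j)) * real d powi j"
        unfolding xK using powd[of j n] j by (simp only: of_nat_mult mult.assoc less_imp_le)
      then have "x / real d powi j = real ((K + 1) * d ^ nat (n - j))"
        using pos[of j] by (metis less_irrefl nonzero_mult_div_cancel_right)
      then have "\<lfloor>x / real d powi j\<rfloor> = int ((K + 1) * d ^ nat (n - j))"
        by (metis floor_of_nat)
      moreover have "d dvd (K + 1) * d ^ nat (n - j)" using j by (intro dvd_mult dvd_power) auto
      ultimately show ?thesis by (metis dvd_imp_mod_0 nat_0 of_nat_0 zmod_int)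
    qed
    have ex: "is_expansion d x (\<lambda>n. nat (\<lfloor>x / real d powi n\<rfloor> mod int d))"
      by (rule is_expansion_floor[OF d x])
    then obtain M where M: "\<And>j. j > M \<Longrightarrow> nat (\<lfloor>x / real d powi j\<rfloor> mod int d) = 0"
      unfolding is_expansion_def by blast
    have "{j. nat (\<lfloor>x / real d powi j\<rfloor> mod int d) \<noteq> 0} \<subseteq> {n..M}"
      using z M by (force simp: not_less[symmetric])
    then have "finite {j. nat (\<lfloor>x / real d powi j\<rfloor> mod int d) \<noteq> 0}"
      using finite_subset finite_atLeastAtMost_int by blast
    then have "finite {j. a j \<noteq> 0}"
      using can ex unfolding is_canonical_expansion_def by blast
    moreover have "{..<n} \<subseteq> {j. a j \<noteq> 0}" using all d by auto
    ultimately have "finite {..<n}" by (rule rev_finite_subset)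
    then show False using infinite_Iio by blast
  qed
  then obtain j0 where j0: "j0 < n" "a j0 \<noteq> d - 1" by blast
  then have aj0: "a j0 + 1 \<le> d - 1" using lt[of j0] by linarith
  have ub: "(\<Sum>j\<in>A. f j) \<le> real d powi n - real d powi j0" if A: "finite A" "A \<subseteq> {..<n}" for A
  proof -
    obtain l u where l: "l \<le> j0" "A \<subseteq> {l..<u}" using finite_int_interval[OF A(1)] by metis
    have split: "{l..<n} = insert j0 ({l..<n} - {j0})" using l j0 by auto
    have "A \<subseteq> {l..<n}" using A l by fastforce
    then have "(\<Sum>j\<in>A. f j) \<le> (\<Sum>j\<in>{l..<n}. f j)" by (intro sum_mono2) (auto simp: fnn)
    also have "\<dots> = f j0 + (\<Sum>j\<in>{l..<n} - {j0}. f j)"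
      using l j0 by (intro sum.remove) auto
    also have "\<dots> \<le> (real (d - 1) * real d powi j0 - real d powi j0)
        + (\<Sum>j\<in>{l..<n} - {j0}. real (d - 1) * real d powi j)"
    proof (rule add_mono)
      have "real (a j0) + 1 \<le> real (d - 1)" using aj0 by (metis of_nat_1 of_nat_add of_nat_mono)
      then have "(real (a j0) + 1) * real d powi j0 \<le> real (d - 1) * real d powi j0"
        by (rule mult_right_mono) (simp)
      then show "f j0 \<le> real (d - 1) * real d powi j0 - real d powi j0"
        unfolding f_def by (simp add: algebra_simps)
      show "(\<Sum>j\<in>{l..<n} - {j0}. f j) \<le> (\<Sum>j\<in>{l..<n} - {j0}. real (d - 1) * real d powi j)"
      proof (rule sum_mono)
        fix j
        have "real (a j) \<le> real (d - 1)" using lt[of j] by simp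
        then show "f j \<le> real (d - 1) * real d powi j" unfolding f_def
          by (rule mult_right_mono) simp
      qed
    qed
    also have "\<dots> = (\<Sum>j\<in>{l..<n}. real (d - 1) * real d powi j) - real d powi j0"
      using l j0 by (subst sum.remove[of "{l..<n}" j0]) auto
    also have "\<dots> \<le> real d powi n - real d powi j0"
      using full[of l] l j0 pos[of l] by simp
    finally show ?thesis .
  qed
  have "T \<le> real d powi n - real d powi j0"
    by (rule has_sum_le_finite_sums[OF T]) (rule ub)
  then have "T < real d powi n" using pos[of j0] by linarith
  moreover have "x / real d powi n = real K + T / real d powi n"
    unfolding xT K using d by (simp add: add_divide_distrib)
  ultimately have "\<lfloor>x / real d powi n\<rfloor> = int K"
    using T0 pos[of n] by (intro floor_unique) auto
  then show ?thesis using Kmod by (metis nat_int zmod_int)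
qed

lemma ex1_canonical_expansion:
  assumes d: "d \<ge> (2::nat)" and x: "x \<ge> 0"
  shows "\<exists>!a. is_canonical_expansion d x a"
proof (rule ex_ex1I)
  show "\<exists>a. is_canonical_expansion d x a"
    using is_expansion_floor[OF d x] unfolding is_canonical_expansion_def by blast
  show "a = b" if "is_canonical_expansion d x a" "is_canonical_expansion d x b" for a b
    using canonical_expansion_floor[OF d x] that by (intro ext) metis
qed

lemma digits_canonical:
  assumes "d \<ge> (2::nat)" "x \<ge> 0"
  shows "is_canonical_expansion d x (digits d x)"
  unfolding digits_def by (rule theI'[OF ex1_canonical_expansion[OF assms]])

lemma digits_eq_floor:
  assumes "d \<ge> (2::nat)" "x \<ge> 0"
  shows "digits d x n = nat (\<lfloor>x / real d powi n\<rfloor> mod int d)"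
  by (rule canonical_expansion_floor[OF assms digits_canonical[OF assms]])

lemma finite_walsh_support:
  assumes "d \<ge> (2::nat)" "k \<ge> 0" "x \<ge> 0"
  shows "finite {n. digits d k n * digits d x (- 1 - n) \<noteq> 0}"
proof -
  obtain m m' where m: "\<And>n. n > m \<Longrightarrow> digits d k n = 0" "\<And>n. n > m' \<Longrightarrow> digits d x n = 0"
    using digits_canonical[OF assms(1,2)] digits_canonical[OF assms(1,3)]
    unfolding is_canonical_expansion_def is_expansion_def by blast
  have "{n. digits d k n * digits d x (- 1 - n) \<noteq> 0} \<subseteq> {- 1 - m'..m}"
  proof
    fix n assume "n \<in> {n. digits d k n * digits d x (- 1 - n) \<noteq> 0}"
    then have "\<not> n > m" "\<not> - 1 - n > m'" using m by fastforce+
    then show "n \<in> {- 1 - m'..m}" by auto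
  qed
  then show ?thesis using finite_subset finite_atLeastAtMost_int by blast
qed

end

theory Submission
  imports Defs
begin

text \<open>
  For \<open>G\<close> on \<open>[0, 3 ^ n)\<close> the integral of \<open>G(t\<^sub>1) * cnj (G(t\<^sub>2))\<close> over \<open>t\<^sub>1 < t\<^sub>2\<close> splits into
  contributions of the triadic scales: at scale \<open>3 ^ (i + 1)\<close> the points \<open>t\<^sub>1\<close> and \<open>t\<^sub>2\<close> lie in
  one triadic interval but in different children of it. By Plancherel each scale contributes at
  most a constant to the \<open>L\<^sup>1\<close> norm in \<open>k\<close>. The counterexample makes every scale contribute a
  quantity of constant size, and makes the contributions of different scales independent, so
  that their sum is a random walk of length \<open>n\<close>, of size \<open>sqrt n\<close> on a fixed proportion of all
  \<open>k\<close> in \<open>[0, 1)\<close>.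

  The function is the chirp \<open>F(t) = 3 powr (- n / 2) * \<gamma> ^ (\<Sum>i<n. t\<^sub>i ^ 2)\<close>. It is a product over
  the digits of \<open>t\<close>, and for \<open>k\<close> in \<open>[0, 1)\<close> so is the Walsh function; hence
  \<open>F(t) * w(k, t)\<close> is a product of factors \<open>\<gamma> ^ (a\<^sup>2 + \<kappa> * a)\<close>, one for each digit \<open>a\<close> of \<open>t\<close>,
  with \<open>\<kappa>\<close> the matching digit of \<open>k\<close>. The sum of this factor over \<open>a\<close> is a cubic Gauss sum,
  of modulus \<open>sqrt 3\<close> whatever \<open>\<kappa>\<close> is, so no scale is ever lost. The sum over \<open>a < b\<close> of the
  factor at \<open>a\<close> times the conjugate of the factor at \<open>b\<close> is \<open>(\<gamma> - \<gamma>\<^sup>2) * (\<kappa> - 1)\<close>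
  (\<open>cubic_gauss_sum\<close>). Splitting off the top digit (\<open>ordered_pair_sum_product\<close>) then gives
  \<open>(\<gamma> - \<gamma>\<^sup>2) / 3 * (\<Sum>i. \<kappa>\<^sub>i - 1)\<close> for the part of the integral with \<open>t\<^sub>1\<close>, \<open>t\<^sub>2\<close> in different unit
  intervals. The number \<open>\<gamma> - \<gamma>\<^sup>2\<close> is imaginary and nonzero, whereas pairs within a unit interval
  contribute a real number; so the imaginary part of the integral over \<open>t\<^sub>1 < t\<^sub>2 < 3 ^ n\<close> is
  proportional to the deviation of the digit sum of \<open>k\<close> from its mean
  (\<open>maximal_fn_chirp_ge\<close>).

  The digits of \<open>k\<close> are independent and uniform, and the second and fourth moments of the
  deviation show in the manner of Paley and Zygmund that its square exceeds \<open>n / 3\<close> on more than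
  a tenth of all \<open>k\<close> in \<open>[0, 1)\<close> (\<open>card_large_digit_deviation\<close>).
  It remains to know that the superlevel set is measurable, which holds because the maximal
  function depends on \<open>k\<close> only through \<open>\<lfloor>k * 3 ^ n\<rfloor>\<close> (\<open>maximal_fn_cong_floor\<close>).
\<close>

section \<open>Moments of the ternary digit sum\<close>

definition ternary_digit :: "nat \<Rightarrow> nat \<Rightarrow> nat" where
  "ternary_digit m i = m div 3 ^ i mod 3"

definition digit_deviation :: "nat \<Rightarrow> nat \<Rightarrow> real" where
  "digit_deviation n m = (\<Sum>i<n. real (ternary_digit m i) - 1)"

lemma ternary_digit_less: "ternary_digit m i < 3"
  by (simp add: ternary_digit_def)

lemma sum_lessThan_mult:
  fixes f :: "nat \<Rightarrow> 'a::comm_monoid_add"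
  shows "(\<Sum>m<n * k. f m) = (\<Sum>q<n. \<Sum>r<k. f (q * k + r))"
proof -
  have "sum f {q * k..<q * k + k} = (\<Sum>r<k. f (q * k + r))" for q
    using sum.shift_bounds_nat_ivl[of f 0 "q * k" k]
    by (simp add: atLeast0LessThan add.commute)
  then show ?thesis by (simp flip: sum.nat_group)
qed

lemma digit_deviation_append:
  assumes "r < 3"
  shows "digit_deviation (Suc n) (q * 3 + r) = digit_deviation n q + (real r - 1)"
proof -
  have "ternary_digit (q * 3 + r) (Suc i) = ternary_digit q i" for i
    using assms by (simp add: ternary_digit_def div_mult2_eq)
  moreover have "ternary_digit (q * 3 + r) 0 = r"
    using assms by (simp add: ternary_digit_def)
  ultimately show ?thesis
    unfolding digit_deviation_def by (simp add: sum.lessThan_Suc_shift del: sum.lessThan_Suc)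
qed

lemma sum_lessThan_three: "(\<Sum>r<3. f r) = f 0 + f 1 + f (2::nat)"
  by (simp add: numeral_3_eq_3 numeral_2_eq_2)

text \<open>Appending a digit moves the deviation by \<open>-1\<close>, \<open>0\<close> or \<open>1\<close>, each for one third of the
  integers. The odd moments cancel in this step, so the second and fourth moments obey closed
  recursions. They are those of a sum of \<open>n\<close> independent uniform steps.\<close>

lemma digit_deviation_moments:
  "(\<Sum>m<3 ^ n. digit_deviation n m ^ 2) = 3 ^ n * (2 * real n / 3)"
  "(\<Sum>m<3 ^ n. digit_deviation n m ^ 4) = 3 ^ n * ((4 * real n ^ 2 - 2 * real n) / 3)"
proof -
  have step: "(\<Sum>m<3 ^ Suc n. digit_deviation (Suc n) m ^ p)
      = (\<Sum>q<3 ^ n. (digit_deviation n q - 1) ^ p + digit_deviation n q ^ p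
          + (digit_deviation n q + 1) ^ p)" for n p
    unfolding power_Suc2 sum_lessThan_mult
    by (simp add: sum_lessThan_three digit_deviation_append[of 0, simplified]
        digit_deviation_append[of 1, simplified] digit_deviation_append[of 2, simplified])
  have second: "(\<Sum>m<3 ^ n. digit_deviation n m ^ 2) = 3 ^ n * (2 * real n / 3)" for n
  proof (induction n)
    case 0
    then show ?case by (simp add: digit_deviation_def)
  next
    case (Suc n)
    have eq: "(y - 1)^2 + y^2 + (y + 1)^2 = 3 * y^2 + 2" for y :: real
      by (simp add: power2_eq_square algebra_simps)
    have "(\<Sum>m<3 ^ Suc n. digit_deviation (Suc n) m ^ 2)
        = 3 * (\<Sum>m<3 ^ n. digit_deviation n m ^ 2) + 2 * 3 ^ n"
      unfolding step eq by (simp add: sum.distrib flip: sum_distrib_left)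
    then show ?case unfolding Suc.IH by (simp add: algebra_simps)
  qed
  show "(\<Sum>m<3 ^ n. digit_deviation n m ^ 2) = 3 ^ n * (2 * real n / 3)"
    by (rule second)
  show "(\<Sum>m<3 ^ n. digit_deviation n m ^ 4) = 3 ^ n * ((4 * real n ^ 2 - 2 * real n) / 3)"
  proof (induction n)
    case 0
    then show ?case by (simp add: digit_deviation_def)
  next
    case (Suc n)
    have eq: "(y - 1)^4 + y^4 + (y + 1)^4 = 3 * y^4 + 12 * y^2 + 2" for y :: real
      by (simp add: power4_eq_xxxx power2_eq_square algebra_simps)
    have "(\<Sum>m<3 ^ Suc n. digit_deviation (Suc n) m ^ 4)
        = 3 * (\<Sum>m<3 ^ n. digit_deviation n m ^ 4)
          + 12 * (\<Sum>m<3 ^ n. digit_deviation n m ^ 2) + 2 * 3 ^ n"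
      unfolding step eq by (simp add: sum.distrib flip: sum_distrib_left)
    then show ?case unfolding Suc.IH second by (simp add: field_simps power2_eq_square)
  qed
qed

text \<open>A form of the Paley--Zygmund inequality: the quadratic \<open>(y - n / 3) * (5 * n - y)\<close> is
  positive only for \<open>y\<close> above \<open>n / 3\<close> and is at most \<open>(7 * n / 3)\<^sup>2\<close>, while its mean at
  \<open>y = digit_deviation n m ^ 2\<close> is at least \<open>5 * n\<^sup>2 / 9\<close>. The proportion is thus at least
  \<open>5 / 49\<close>. The upper root \<open>5 * n\<close> only has to be so large that the mean is positive.\<close>

lemma card_large_digit_deviation:
  assumes "n > 0"
  shows "3 ^ n / 10 < real (card {m. m < 3 ^ n \<and> digit_deviation n m ^ 2 > n / 3})"
proof -
  define G where "G = {m. m < 3 ^ n \<and> digit_deviation n m ^ 2 > n / 3}"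
  have pointwise: "(y - n / 3) * (5 * n - y) \<le> (if y > n / 3 then 49 / 9 * real n ^ 2 else 0)"
    for y :: real
  proof (cases "y > n / 3")
    case True
    \<comment> \<open>The maximum is at the midpoint \<open>8 * n / 3\<close> of the two roots.\<close>
    have "0 \<le> (y - 8 / 3 * n)\<^sup>2" by simp
    then show ?thesis using True by (simp add: power2_eq_square algebra_simps)
  next
    case False
    then have "y - n / 3 \<le> 0" "0 \<le> 5 * n - y" by auto
    then show ?thesis using False by (simp add: mult_nonpos_nonneg)
  qed
  have "(\<Sum>m<3 ^ n. (digit_deviation n m ^ 2 - n / 3) * (5 * n - digit_deviation n m ^ 2))
     = (\<Sum>m<3 ^ n. 16 / 3 * n * digit_deviation n m ^ 2 - digit_deviation n m ^ 4
          - 5 / 3 * real n ^ 2)"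
    by (rule sum.cong) (auto simp: power4_eq_xxxx power2_eq_square algebra_simps)
  also have "\<dots> = 16 / 3 * n * (3 ^ n * (2 * real n / 3))
      - 3 ^ n * ((4 * real n ^ 2 - 2 * real n) / 3) - 3 ^ n * (5 / 3 * real n ^ 2)"
    unfolding sum_subtractf sum_distrib_left[symmetric] digit_deviation_moments by simp
  also have "\<dots> = 3 ^ n * (5 / 9 * real n ^ 2 + 2 / 3 * n)"
    by (simp add: field_simps power2_eq_square)
  finally have total: "(\<Sum>m<3 ^ n. (digit_deviation n m ^ 2 - n / 3) * (5 * n - digit_deviation n m ^ 2))
      = 3 ^ n * (5 / 9 * real n ^ 2 + 2 / 3 * n)" .
  have "3 ^ n * (5 / 9 * real n ^ 2 + 2 / 3 * n)
      \<le> (\<Sum>m<3 ^ n. if digit_deviation n m ^ 2 > n / 3 then 49 / 9 * real n ^ 2 else 0)"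
    by (subst total[symmetric]) (intro sum_mono pointwise)
  also have "\<dots> = (\<Sum>m\<in>G. 49 / 9 * real n ^ 2)"
    by (rule sum.mono_neutral_cong_right) (auto simp: G_def)
  finally have "3 ^ n * (5 / 9 * real n ^ 2 + 2 / 3 * n) \<le> real (card G) * (49 / 9 * real n ^ 2)"
    by simp
  moreover have "3 ^ n * (49 / 90 * real n ^ 2) < 3 ^ n * (5 / 9 * real n ^ 2 + 2 / 3 * n)"
  proof -
    have "49 / 90 * real n ^ 2 \<le> 5 / 9 * real n ^ 2" by simp
    moreover have "0 < 2 / 3 * real n" using assms by simp
    ultimately have "49 / 90 * real n ^ 2 < 5 / 9 * real n ^ 2 + 2 / 3 * n" by linarith
    then show ?thesis by simp
  qed
  ultimately have "3 ^ n / 10 * (49 / 9 * real n ^ 2) < real (card G) * (49 / 9 * real n ^ 2)"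
    by (simp add: field_simps)
  then show ?thesis unfolding G_def by (rule mult_right_less_imp_less) simp
qed

section \<open>Ordered double sums of digit products\<close>

text \<open>The discrete counterpart of the integral over \<open>t\<^sub>1 < t\<^sub>2\<close>.\<close>

definition ordered_pair_sum :: "nat \<Rightarrow> (nat \<Rightarrow> complex) \<Rightarrow> complex" where
  "ordered_pair_sum L c = (\<Sum>m<L. (\<Sum>l<m. c l) * cnj (c m))"

text \<open>Pairs in increasing order either differ in the top digit, and then the lower parts range
  freely, or agree in it, and then the lower parts are in increasing order.\<close>

lemma ordered_pair_sum_product:
  assumes c: "\<And>a r. a < N \<Longrightarrow> r < L \<Longrightarrow> c (a * L + r) = h a * p r"
  shows "ordered_pair_sum (N * L) c
    = ordered_pair_sum N h * ((\<Sum>r<L. p r) * cnj (\<Sum>r<L. p r))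
      + (\<Sum>a<N. h a * cnj (h a)) * ordered_pair_sum L p"
proof -
  define W where "W = (\<Sum>r<L. p r)"
  have partial: "(\<Sum>l<a * L + r. c l) = (\<Sum>b<a. h b) * W + h a * (\<Sum>s<r. p s)"
    if "a < N" "r < L" for a r
  proof -
    have "(\<Sum>l<a * L + r. c l) = (\<Sum>l<a * L. c l) + (\<Sum>s<r. c (a * L + s))"
      using sum.nat_group[of c 1 1] sum.atLeastLessThan_concat[of 0 "a * L" "a * L + r" c]
        sum.shift_bounds_nat_ivl[of c 0 "a * L" r]
      by (simp add: atLeast0LessThan add.commute)
    also have "(\<Sum>l<a * L. c l) = (\<Sum>b<a. h b) * W"
      using that by (simp add: sum_lessThan_mult W_def sum_product c)
    also have "(\<Sum>s<r. c (a * L + s)) = h a * (\<Sum>s<r. p s)"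
      using that by (simp add: sum_distrib_left c)
    finally show ?thesis .
  qed
  have "ordered_pair_sum (N * L) c
    = (\<Sum>a<N. \<Sum>r<L. ((\<Sum>b<a. h b) * W + h a * (\<Sum>s<r. p s)) * cnj (h a * p r))"
    unfolding ordered_pair_sum_def sum_lessThan_mult by (simp add: partial c)
  also have "\<dots> = (\<Sum>a<N. (\<Sum>b<a. h b) * cnj (h a) * (W * cnj W)
        + h a * cnj (h a) * ordered_pair_sum L p)"
  proof (rule sum.cong)
    fix a
    have "((\<Sum>b<a. h b) * W + h a * (\<Sum>s<r. p s)) * cnj (h a * p r)
       = (\<Sum>b<a. h b) * cnj (h a) * W * cnj (p r)
         + h a * cnj (h a) * ((\<Sum>s<r. p s) * cnj (p r))" for r
      by (simp add: algebra_simps)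
    then show "(\<Sum>r<L. ((\<Sum>b<a. h b) * W + h a * (\<Sum>s<r. p s)) * cnj (h a * p r))
       = (\<Sum>b<a. h b) * cnj (h a) * (W * cnj W) + h a * cnj (h a) * ordered_pair_sum L p"
      by (simp only: sum.distrib sum_distrib_left[symmetric] ordered_pair_sum_def)
        (simp add: W_def)
  qed simp
  finally show ?thesis
    by (simp add: sum.distrib sum_distrib_right[symmetric] ordered_pair_sum_def W_def)
qed

lemma primitive_cube_root:
  assumes "primitive_root_of_unity 3 \<gamma>"
  shows "\<gamma> ^ 3 = 1" "cmod \<gamma> = 1" "\<gamma> ^ 2 = - 1 - \<gamma>" "cnj \<gamma> = - 1 - \<gamma>" "(Im \<gamma>)\<^sup>2 = 3 / 4"
proof -
  show cube: "\<gamma> ^ 3 = 1" using assms by (simp add: primitive_root_of_unity_def)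
  have "\<gamma> ^ 1 \<noteq> 1" using assms unfolding primitive_root_of_unity_def
    by (metis one_less_numeral_iff semiring_norm(77) zero_less_one)
  then have ne: "\<gamma> - 1 \<noteq> 0" by simp
  have "(\<gamma> - 1) * (\<gamma> ^ 2 + \<gamma> + 1) = \<gamma> ^ 3 - 1"
    by (simp add: power2_eq_square power3_eq_cube algebra_simps)
  then have "\<gamma> ^ 2 + \<gamma> + 1 = 0" using ne cube by simp
  then show sq: "\<gamma> ^ 2 = - 1 - \<gamma>" by algebra
  have "cmod \<gamma> ^ 3 = 1" using cube by (metis norm_one norm_power)
  then show nrm: "cmod \<gamma> = 1" using power_eq_imp_eq_base[of "cmod \<gamma>" 3 1] by simp
  then have "\<gamma> * cnj \<gamma> = 1" using complex_norm_square[of \<gamma>] by simp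
  moreover have "\<gamma> * (- 1 - \<gamma>) = 1" using sq by algebra
  moreover have "\<gamma> \<noteq> 0" using nrm by auto
  ultimately show cnj: "cnj \<gamma> = - 1 - \<gamma>" by (metis mult_left_cancel)
  then have "Re (cnj \<gamma>) = Re (- 1 - \<gamma>)" by simp
  then have re: "Re \<gamma> = - 1 / 2" by simp
  have "(Re \<gamma>)\<^sup>2 + (Im \<gamma>)\<^sup>2 = 1" using nrm by (simp flip: cmod_power2)
  then show "(Im \<gamma>)\<^sup>2 = 3 / 4" unfolding re by (simp add: power2_eq_square)
qed

text \<open>The sum of \<open>h\<close> measures how much mass a scale passes on to the next one, and the ordered
  pair sum is what the scale contributes itself. Completing the square explains the constant
  modulus of the former; the latter is a shift of \<open>\<kappa>\<close> by its mean, which makes the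
  contributions of all scales add up to a digit sum.\<close>

lemma cubic_gauss_sum:
  assumes "primitive_root_of_unity 3 \<gamma>" "\<kappa> < 3"
  defines "h \<equiv> \<lambda>a. \<gamma> ^ (a ^ 2 + \<kappa> * a)"
  shows "(\<Sum>a<3. h a) * cnj (\<Sum>a<3. h a) = 3"
    and "(\<Sum>a<3. h a * cnj (h a)) = 3"
    and "ordered_pair_sum 3 h = (\<gamma> - \<gamma> ^ 2) * (of_nat \<kappa> - 1)"
proof -
  note root = primitive_cube_root[OF assms(1)]
  have pw: "\<gamma> ^ 4 = \<gamma>" "\<gamma> ^ 6 = 1" "\<gamma> ^ 8 = - 1 - \<gamma>"
    using root(1,3) by algebra+
  have mul: "\<gamma> * \<gamma> = - 1 - \<gamma>" using root(3) by (simp add: power2_eq_square)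
  have mul': "\<gamma> * (\<gamma> * z) = (- 1 - \<gamma>) * z" for z using mul by (metis mult.assoc)
  have "h a * cnj (h a) = 1" for a
    using root(2) complex_norm_square[of "h a"] by (simp add: h_def norm_power)
  then show "(\<Sum>a<3. h a * cnj (h a)) = 3" by simp
  have "\<kappa> = 0 \<or> \<kappa> = 1 \<or> \<kappa> = 2" using assms(2) by auto
  then obtain u v where h: "h 0 = 1" "h 1 = u" "h 2 = v"
    and val: "\<kappa> = 0 \<and> u = \<gamma> \<and> v = \<gamma> \<or> \<kappa> = 1 \<and> u = - 1 - \<gamma> \<and> v = 1
      \<or> \<kappa> = 2 \<and> u = 1 \<and> v = - 1 - \<gamma>"
    by (elim disjE) (simp_all add: h_def pw mul right_diff_distrib)
  show "(\<Sum>a<3. h a) * cnj (\<Sum>a<3. h a) = 3"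
    using val unfolding sum_lessThan_three h
    by (elim disjE conjE; hypsubst; simp add: root(4) algebra_simps mul mul')
  have "ordered_pair_sum 3 h = cnj u + (1 + u) * cnj v"
    unfolding ordered_pair_sum_def sum_lessThan_three h(3) using h
    by (simp add: numeral_2_eq_2)
  then show "ordered_pair_sum 3 h = (\<gamma> - \<gamma> ^ 2) * (of_nat \<kappa> - 1)"
    using val unfolding root(3)
    by (elim disjE conjE; hypsubst; simp add: root(4) algebra_simps mul mul')
qed

text \<open>With \<open>\<kappa> = 0\<close> these are the coefficients of the function sought, up to normalization.
  Multiplying by a Walsh function changes \<open>\<kappa>\<close> to a sequence of digits of \<open>k\<close> and so
  stays in the family.\<close>

definition chirp :: "complex \<Rightarrow> (nat \<Rightarrow> nat) \<Rightarrow> nat \<Rightarrow> nat \<Rightarrow> complex" where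
  "chirp \<gamma> \<kappa> n m = (\<Prod>i<n. \<gamma> ^ (ternary_digit m i ^ 2 + \<kappa> i * ternary_digit m i))"

lemma chirp_top_digit:
  assumes "a < 3" "r < 3 ^ n"
  shows "chirp \<gamma> \<kappa> (Suc n) (a * 3 ^ n + r) = \<gamma> ^ (a ^ 2 + \<kappa> n * a) * chirp \<gamma> \<kappa> n r"
proof -
  have "ternary_digit (a * 3 ^ n + r) n = a" using assms by (simp add: ternary_digit_def)
  moreover have "ternary_digit (a * 3 ^ n + r) i = ternary_digit r i" if "i < n" for i
  proof -
    have "(3::nat) ^ n = 3 ^ i * (3 * 3 ^ (n - Suc i))"
      using that by (metis Suc_diff_Suc le_add_diff_inverse less_imp_le power_Suc power_add)
    then have "a * 3 ^ n + r = 3 ^ i * (3 * (a * 3 ^ (n - Suc i))) + r" by simp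
    then have "(a * 3 ^ n + r) div 3 ^ i = 3 * (a * 3 ^ (n - Suc i)) + r div 3 ^ i"
      by (metis add.commute div_mult_self2 power_not_zero zero_neq_numeral)
    then show ?thesis by (simp add: ternary_digit_def)
  qed
  ultimately show ?thesis by (simp add: chirp_def mult.commute)
qed

text \<open>By the Gauss sum evaluation the full sum of \<open>n\<close> digits has squared modulus \<open>3 ^ n\<close>. A new top
  digit hence adds \<open>3 ^ n\<close> times its own ordered pair sum, and multiplies the old ordered pair
  sum by \<open>3\<close>.\<close>

lemma ordered_pair_sum_chirp:
  assumes "primitive_root_of_unity 3 \<gamma>" "\<And>i. \<kappa> i < 3"
  shows "ordered_pair_sum (3 ^ n) (chirp \<gamma> \<kappa> n)
      = 3 ^ n * ((\<gamma> - \<gamma> ^ 2) / 3 * (\<Sum>i<n. of_nat (\<kappa> i) - 1))"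
proof -
  define W where "W n = (\<Sum>m<3 ^ n. chirp \<gamma> \<kappa> n m)" for n
  define h where "h n a = \<gamma> ^ (a ^ 2 + \<kappa> n * a)" for n a
  note gauss = cubic_gauss_sum[OF assms, folded h_def]
  have top: "chirp \<gamma> \<kappa> (Suc n) (a * 3 ^ n + r) = h n a * chirp \<gamma> \<kappa> n r"
    if "a < 3" "r < 3 ^ n" for a r n
    using chirp_top_digit[OF that] by (simp add: h_def)
  have W_Suc: "W (Suc n) = (\<Sum>a<3. h n a) * W n" for n
    by (simp add: W_def sum_lessThan_mult top sum_product)
  have W_sq: "W n * cnj (W n) = 3 ^ n" for n
  proof (induction n)
    case 0
    then show ?case by (simp add: W_def chirp_def)
  next
    case (Suc n)
    have "W (Suc n) * cnj (W (Suc n))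
        = (\<Sum>a<3. h n a) * cnj (\<Sum>a<3. h n a) * (W n * cnj (W n))"
      unfolding W_Suc by simp
    then show ?case unfolding gauss Suc.IH by simp
  qed
  show "ordered_pair_sum (3 ^ n) (chirp \<gamma> \<kappa> n)
      = 3 ^ n * ((\<gamma> - \<gamma> ^ 2) / 3 * (\<Sum>i<n. of_nat (\<kappa> i) - 1))"
  proof (induction n)
    case 0
    then show ?case by (simp add: ordered_pair_sum_def)
  next
    case (Suc n)
    have "ordered_pair_sum (3 ^ Suc n) (chirp \<gamma> \<kappa> (Suc n))
      = ordered_pair_sum 3 (h n) * (W n * cnj (W n))
        + (\<Sum>a<3. h n a * cnj (h n a)) * ordered_pair_sum (3 ^ n) (chirp \<gamma> \<kappa> n)"
      unfolding W_def power_Suc by (rule ordered_pair_sum_product) (rule top)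
    also have "\<dots> = (\<gamma> - \<gamma> ^ 2) * (of_nat (\<kappa> n) - 1) * 3 ^ n
        + 3 * (3 ^ n * ((\<gamma> - \<gamma> ^ 2) / 3 * (\<Sum>i<n. of_nat (\<kappa> i) - 1)))"
      unfolding gauss W_sq Suc.IH ..
    also have "\<dots> = 3 ^ Suc n * ((\<gamma> - \<gamma> ^ 2) / 3 * (\<Sum>i<Suc n. of_nat (\<kappa> i) - 1))"
      by (simp add: field_simps)
    finally show ?case .
  qed
qed

section \<open>Step functions on unit intervals\<close>

definition unit_step :: "nat \<Rightarrow> (nat \<Rightarrow> complex) \<Rightarrow> real \<Rightarrow> complex" where
  "unit_step L c t = (\<Sum>m<L. c m * indicator {real m..<real m + 1} t)"

lemma in_unit_interval_iff: "t \<in> {real m..<real m + 1} \<longleftrightarrow> 0 \<le> t \<and> m = nat \<lfloor>t\<rfloor>"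
proof -
  have "t \<in> {real m..<real m + 1} \<longleftrightarrow> \<lfloor>t\<rfloor> = int m" by (auto simp: floor_eq_iff)
  then show ?thesis by auto
qed

lemma unit_step_eq:
  "unit_step L c t = (if 0 \<le> t \<and> t < real L then c (nat \<lfloor>t\<rfloor>) else 0)"
proof -
  have *: "c m * indicator {real m..<real m + 1} t
      = (if m = nat \<lfloor>t\<rfloor> then if 0 \<le> t then c m else 0 else 0)" for m
    using in_unit_interval_iff[of t m] by (auto simp: indicator_def)
  have "0 \<le> t \<Longrightarrow> nat \<lfloor>t\<rfloor> < L \<longleftrightarrow> t < real L"
    by (simp add: nat_less_iff floor_less_iff)
  then show ?thesis unfolding unit_step_def * by simp
qed

lemma adic_step_function_unit_step: "adic_step_function d (unit_step L c)"
proof -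
  define J where "J m = {real m..<real m + 1}" for m
  have inj: "inj_on J A" for A
  proof (rule inj_onI)
    fix l m assume "J l = J m"
    moreover have "real l \<in> J l" by (simp add: J_def)
    ultimately have "real l \<in> J m" by simp
    then show "l = m" unfolding J_def in_unit_interval_iff by simp
  qed
  have "unit_step L c = (\<lambda>t. \<Sum>I\<in>J ` {..<L}. c (inv J I) * indicator I t)"
    by (rule ext) (simp add: sum.reindex[OF inj] inv_f_f[OF inj] unit_step_def J_def[symmetric])
  moreover have "adic_interval d (J m)" for m
    unfolding adic_interval_def J_def by (rule exI[of _ 0], rule exI[of _ m]) simp
  ultimately show ?thesis unfolding adic_step_function_def
    by (intro exI[of _ "J ` {..<L}"] exI[of _ "\<lambda>I. c (inv J I)"]) auto
qed

lemma L2_norm_unit_step: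
  "L2_norm_nonneg (unit_step L c) = sqrt (\<Sum>m<L. (cmod (c m))\<^sup>2)"
proof -
  have "indicator {0..} t *\<^sub>R (cmod (unit_step L c t))\<^sup>2
      = (\<Sum>m<L. (cmod (c m))\<^sup>2 * indicator {real m..<real m + 1} t)" for t :: real
  proof -
    have "(\<Sum>m<L. (cmod (c m))\<^sup>2 * indicator {real m..<real m + 1} t)
        = Re (unit_step L (\<lambda>m. of_real ((cmod (c m))\<^sup>2)) t)"
      unfolding unit_step_def by (simp add: indicator_def if_distrib cong: if_cong)
    then show ?thesis by (auto simp: unit_step_eq indicator_def simp flip: of_real_power)
  qed
  then have "(LINT t:{0..}|lborel. (cmod (unit_step L c t))\<^sup>2)
      = (\<integral>t. (\<Sum>m<L. (cmod (c m))\<^sup>2 * indicator {real m..<real m + 1} t) \<partial>lborel)"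
    unfolding set_lebesgue_integral_def by simp
  also have "\<dots> = (\<Sum>m<L. (cmod (c m))\<^sup>2)"
    by (subst Bochner_Integration.integral_sum) auto
  finally show ?thesis by (simp add: L2_norm_nonneg_def)
qed

text \<open>A pair of unit intervals contributes a product of two coefficients times the area of a
  square, a triangle or the empty set. The triangles occur on the diagonal, where the product
  is \<open>(cmod (c m))\<^sup>2\<close>; their contribution is real whatever their area is, and taking imaginary
  parts leaves the squares.\<close>

lemma Im_triangle_integral_unit_step:
  "Im (LINT t:{(t1, t2). 0 \<le> t1 \<and> t1 < t2 \<and> t2 < real L}|lborel \<Otimes>\<^sub>M lborel.
      unit_step L c (fst t) * cnj (unit_step L c (snd t))) = Im (ordered_pair_sum L c)"
proof -
  define J where "J m = {real m..<real m + 1}" for m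
  define B where "B l m = {t \<in> J l \<times> J m. fst t < snd t}" for l m
  let ?M = "lborel \<Otimes>\<^sub>M lborel :: (real \<times> real) measure"
  have cnj_indicator: "cnj (indicator A x) = indicator A x" for A and x :: real
    by (simp add: indicator_def)
  have box: "emeasure ?M (J l \<times> J m) = 1" for l m
    by (subst lborel.emeasure_pair_measure_Times) (auto simp: J_def)
  have box_meas: "J l \<times> J m \<in> sets ?M" for l m
    unfolding J_def by (intro pair_measureI) auto
  have "B l m = J l \<times> J m \<inter> {t \<in> space ?M. fst t < snd t}" for l m
    by (auto simp: B_def space_pair_measure)
  moreover have "{t \<in> space ?M. fst t < snd t} \<in> sets ?M" by measurable
  ultimately have B_meas: "B l m \<in> sets ?M" for l m using box_meas by auto
  have "emeasure ?M (B l m) \<le> emeasure ?M (J l \<times> J m)" for l m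
    by (rule emeasure_mono[OF _ box_meas]) (auto simp: B_def)
  then have B_fin: "emeasure ?M (B l m) < \<infinity>" for l m
    by (metis box ennreal_one_less_top infinity_ennreal_def le_less_trans)
  have B_above: "measure ?M (B l m) = 1" if "l < m" for l m
  proof -
    have "real l + 1 \<le> real m" using that by linarith
    then have "B l m = J l \<times> J m" by (auto simp: B_def J_def)
    then show ?thesis by (simp add: measure_def box)
  qed
  have B_below: "B l m = {}" if "m < l" for l m
  proof -
    have "real m + 1 \<le> real l" using that by linarith
    then show ?thesis by (auto simp: B_def J_def)
  qed
  have pw: "indicator {(t1, t2). 0 \<le> t1 \<and> t1 < t2 \<and> t2 < real L} t *\<^sub>R
       (unit_step L c (fst t) * cnj (unit_step L c (snd t)))
      = (\<Sum>m<L. \<Sum>l<L. c l * cnj (c m) * indicator (B l m) t)" for t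
  proof -
    have eq: "unit_step L c (fst t) * cnj (unit_step L c (snd t))
        = (\<Sum>m<L. \<Sum>l<L. c l * cnj (c m) * (indicator (J l) (fst t) * indicator (J m) (snd t)))"
      unfolding unit_step_def J_def[symmetric] cnj_sum complex_cnj_mult cnj_indicator
      by (subst sum.swap) (simp only: sum_product mult_ac)
    have indicator_B: "indicator (B l m) t = (if fst t < snd t then 1 else 0)
        * (indicator (J l) (fst t) * (indicator (J m) (snd t) :: complex))" for l m
      by (simp add: B_def indicator_def mem_Times_iff)
    have "(if fst t < snd t then 1 else 0) * (unit_step L c (fst t) * cnj (unit_step L c (snd t)))
        = (\<Sum>m<L. \<Sum>l<L. c l * cnj (c m) * indicator (B l m) t)"
      unfolding eq indicator_B
      by (cases "fst t < snd t") (simp_all only: if_True if_False mult_1 mult_zero_left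
          mult_zero_right sum.neutral_const)
    moreover have "indicator {(t1, t2). 0 \<le> t1 \<and> t1 < t2 \<and> t2 < real L} t *\<^sub>R
       (unit_step L c (fst t) * cnj (unit_step L c (snd t)))
       = (if fst t < snd t then 1 else 0) * (unit_step L c (fst t) * cnj (unit_step L c (snd t)))"
      by (auto simp: unit_step_eq indicator_def split: prod.splits)
    ultimately show ?thesis by simp
  qed
  have int: "integrable ?M (\<lambda>t. c l * cnj (c m) * indicator (B l m) t)" for l m
  proof (rule integrable_mult_right)
    show "integrable ?M (\<lambda>t. indicator (B l m) t :: complex)"
      using integrable_of_real[OF integrable_real_indicator[OF B_meas B_fin], where 'a = complex]
      by (simp add: of_real_indicator)
  qed
  have integral_B: "(LINT t|?M. indicator (B l m) t :: complex) = measure ?M (B l m)" for l m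
    using integral_of_real[of ?M "indicator (B l m)", where 'a = complex] B_meas B_fin
    by (simp add: of_real_indicator)
  have "(LINT t:{(t1, t2). 0 \<le> t1 \<and> t1 < t2 \<and> t2 < real L}|?M.
      unit_step L c (fst t) * cnj (unit_step L c (snd t)))
      = (\<Sum>m<L. \<Sum>l<L. c l * cnj (c m) * measure ?M (B l m))"
    unfolding set_lebesgue_integral_def pw
    by (simp only: Bochner_Integration.integral_sum Bochner_Integration.integrable_sum int
        integral_mult_right_zero integral_B)
  also have "\<dots> = (\<Sum>m<L. (\<Sum>l<m. c l) * cnj (c m) + (cmod (c m))\<^sup>2 * measure ?M (B m m))"
  proof (rule sum.cong)
    fix m assume "m \<in> {..<L}"
    then have "(\<Sum>l<L. c l * cnj (c m) * measure ?M (B l m))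
        = (\<Sum>l<Suc m. c l * cnj (c m) * measure ?M (B l m))"
      by (intro sum.mono_neutral_right) (auto simp: B_below not_less_eq)
    then show "(\<Sum>l<L. c l * cnj (c m) * measure ?M (B l m))
        = (\<Sum>l<m. c l) * cnj (c m) + (cmod (c m))\<^sup>2 * measure ?M (B m m)"
      by (simp add: B_above sum_distrib_right flip: complex_norm_square)
  qed simp
  finally show ?thesis
    by (simp add: sum.distrib ordered_pair_sum_def)
qed

section \<open>Walsh functions and integer digits\<close>

text \<open>The shift by \<open>n\<close> serves two purposes: with \<open>n = 0\<close> it describes the digits of \<open>t\<close> to the left
  of the point, and otherwise the first \<open>n\<close> digits of \<open>k\<close> to the right of it.\<close>

lemma digits_eq_ternary_digit:
  assumes "x \<ge> 0"
  shows "digits 3 x (int i - int n) = ternary_digit (nat \<lfloor>x * 3 ^ n\<rfloor>) i"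
proof -
  have "x / 3 powi (int i - int n) = x * 3 ^ n / real_of_int (3 ^ i)"
    by (simp add: power_int_diff)
  then have "\<lfloor>x / 3 powi (int i - int n)\<rfloor> = \<lfloor>x * 3 ^ n\<rfloor> div 3 ^ i"
    by (metis floor_divide_real_eq_div zero_le_numeral zero_le_power)
  then show ?thesis
    using assms by (simp add: digits_eq_floor ternary_digit_def nat_mod_distrib nat_div_distrib
        nat_power_eq pos_imp_zdiv_nonneg_iff)
qed

lemma digits_above_eq_0:
  assumes "0 \<le> x" "x < 3 ^ n" "int n \<le> l"
  shows "digits 3 x l = 0"
proof -
  have "(3::real) powi int n \<le> 3 powi l" using assms by (intro power_int_increasing) auto
  then have "\<lfloor>x / 3 powi l\<rfloor> = 0" using assms by (simp add: floor_eq_iff)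
  then show ?thesis using assms by (simp add: digits_eq_floor)
qed

text \<open>The digits of \<open>k\<close> lost in the floor, at positions below \<open>- n\<close>, are paired with digits of
  \<open>t\<close> at positions \<open>n\<close> and above, which vanish.\<close>

lemma walsh_cong_floor:
  assumes "0 \<le> k" "0 \<le> k'" "\<lfloor>k * 3 ^ n\<rfloor> = \<lfloor>k' * 3 ^ n\<rfloor>" "0 \<le> t" "t < 3 ^ n"
  shows "walsh 3 \<gamma> k t = walsh 3 \<gamma> k' t"
proof -
  have eq: "digits 3 k l * digits 3 t (- 1 - l) = digits 3 k' l * digits 3 t (- 1 - l)" for l
  proof (cases "l < - int n")
    case True
    then show ?thesis using digits_above_eq_0[OF assms(4,5), of "- 1 - l"] by simp
  next
    case False
    then have "l = int (nat (l + int n)) - int n" by simp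
    then show ?thesis using digits_eq_ternary_digit assms(1-3) by metis
  qed
  show ?thesis unfolding walsh_def by (simp only: eq)
qed

text \<open>For \<open>k < 1\<close> the fractional digits of \<open>t\<close> meet zeros of \<open>k\<close>. The pairing reverses the order
  of digits: the lowest digit of the integer part of \<open>t\<close> goes with the first digit of \<open>k\<close>,
  which is the top digit of \<open>\<lfloor>k * 3 ^ n\<rfloor>\<close>.\<close>

lemma walsh_eq_digit_sum:
  assumes "0 \<le> k" "k < 1" "0 \<le> t" "t < 3 ^ n"
  shows "walsh 3 \<gamma> k t
    = \<gamma> ^ (\<Sum>i<n. ternary_digit (nat \<lfloor>k * 3 ^ n\<rfloor>) (n - Suc i) * ternary_digit (nat \<lfloor>t\<rfloor>) i)"
proof -
  let ?f = "\<lambda>l. digits 3 k l * digits 3 t (- 1 - l)"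
  have "{l. ?f l \<noteq> 0} \<subseteq> (\<lambda>i. - 1 - int i) ` {..<n}"
  proof
    fix l assume "l \<in> {l. ?f l \<noteq> 0}"
    then have "\<not> 0 \<le> l" "\<not> int n \<le> - 1 - l"
      using digits_above_eq_0[of k 0 l] digits_above_eq_0[of t n "- 1 - l"] assms by auto
    then show "l \<in> (\<lambda>i. - 1 - int i) ` {..<n}"
      by (intro image_eqI[of _ _ "nat (- 1 - l)"]) auto
  qed
  then have "sum ?f {l. ?f l \<noteq> 0} = sum ?f ((\<lambda>i. - 1 - int i) ` {..<n})"
    by (intro sum.mono_neutral_left) auto
  also have "\<dots> = (\<Sum>i<n. ?f (- 1 - int i))"
    by (subst sum.reindex) (auto simp: inj_on_def)
  also have "\<dots> = (\<Sum>i<n. ternary_digit (nat \<lfloor>k * 3 ^ n\<rfloor>) (n - Suc i) * ternary_digit (nat \<lfloor>t\<rfloor>) i)"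
  proof (rule sum.cong)
    fix i assume i: "i \<in> {..<n}"
    then have "- 1 - int i = int (n - Suc i) - int n" by auto
    then have "digits 3 k (- 1 - int i) = ternary_digit (nat \<lfloor>k * 3 ^ n\<rfloor>) (n - Suc i)"
      using digits_eq_ternary_digit[OF assms(1)] by metis
    moreover have "digits 3 t (int i) = ternary_digit (nat \<lfloor>t\<rfloor>) i"
      using digits_eq_ternary_digit[OF assms(3), of i 0] by simp
    ultimately show "?f (- 1 - int i)
        = ternary_digit (nat \<lfloor>k * 3 ^ n\<rfloor>) (n - Suc i) * ternary_digit (nat \<lfloor>t\<rfloor>) i" by simp
  qed simp
  finally show ?thesis unfolding walsh_def by simp
qed

lemma maximal_fn_cong_floor:
  assumes "0 \<le> k" "0 \<le> k'" "\<lfloor>k * 3 ^ n\<rfloor> = \<lfloor>k' * 3 ^ n\<rfloor>"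
  shows "maximal_fn 3 \<gamma> (unit_step (3 ^ n) c) k = maximal_fn 3 \<gamma> (unit_step (3 ^ n) c) k'"
proof -
  have eq: "unit_step (3 ^ n) c t * walsh 3 \<gamma> k t = unit_step (3 ^ n) c t * walsh 3 \<gamma> k' t" for t
    using walsh_cong_floor[OF assms] by (auto simp: unit_step_eq)
  show ?thesis unfolding maximal_fn_def by (simp only: eq)
qed

text \<open>Without measurability, a lower bound for the measure of a subset would say nothing about
  \<^const>\<open>emeasure\<close>, which is \<open>0\<close> at sets outside the \<open>\<sigma>\<close>-algebra.\<close>

lemma measurable_maximal_fn_superlevel:
  "{k. 0 \<le> k \<and> maximal_fn 3 \<gamma> (unit_step (3 ^ n) c) k > y} \<in> sets lebesgue"
proof -
  let ?M = "maximal_fn 3 \<gamma> (unit_step (3 ^ n) c)"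
  have floor: "?M k = ?M (of_int \<lfloor>k * 3 ^ n\<rfloor> / 3 ^ n)" if "0 \<le> k" for k
    using that by (intro maximal_fn_cong_floor) auto
  have "{k. 0 \<le> k \<and> ?M k > y} = {k. 0 \<le> k \<and> ?M (of_int \<lfloor>k * 3 ^ n\<rfloor> / 3 ^ n) > y}"
    by (intro Collect_cong conj_cong refl) (simp only: floor)
  also have "\<dots> = {0..} \<inter> ((\<lambda>k. \<lfloor>k * 3 ^ n\<rfloor>) -` {j. ?M (of_int j / 3 ^ n) > y} \<inter> space borel)"
    by auto
  also have "\<dots> \<in> sets borel"
    by (intro sets.Int measurable_sets[where A = "count_space UNIV"]) auto
  finally show ?thesis by (simp add: sets_completionI_sets)
qed

section \<open>The counterexample\<close>

text \<open>The supremum is bounded below by its value at \<open>x = 3 ^ n\<close>, the end of the support, where the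
  imaginary part of the integral is \<open>2 / 3 * Im \<gamma>\<close> times the digit deviation. The factor
  \<open>1 / 2\<close> is a rational lower bound for \<open>2 / 3 * \<bar>Im \<gamma>\<bar> = 1 / sqrt 3\<close>.\<close>

lemma maximal_fn_chirp_ge:
  fixes n :: nat
  assumes \<gamma>: "primitive_root_of_unity 3 \<gamma>" and k: "0 \<le> k" "k < 1"
  defines "F \<equiv> unit_step (3 ^ n) (\<lambda>m. chirp \<gamma> (\<lambda>_. 0) n m / sqrt (3 ^ n))"
  shows "ereal (\<bar>digit_deviation n (nat \<lfloor>k * 3 ^ n\<rfloor>)\<bar> / 2) \<le> maximal_fn 3 \<gamma> F k"
proof -
  define \<kappa> where "\<kappa> i = ternary_digit (nat \<lfloor>k * 3 ^ n\<rfloor>) (n - Suc i)" for i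
  define S where "S = digit_deviation n (nat \<lfloor>k * 3 ^ n\<rfloor>)"
  define c where "c m = chirp \<gamma> \<kappa> n m / sqrt (3 ^ n)" for m
  define D where "D = (LINT t:{(t1, t2). 0 \<le> t1 \<and> t1 < t2 \<and> t2 < (3::real) ^ n}|lborel \<Otimes>\<^sub>M lborel.
     F (fst t) * walsh 3 \<gamma> k (fst t) * cnj (F (snd t) * walsh 3 \<gamma> k (snd t)))"
  have Fw: "F t * walsh 3 \<gamma> k t = unit_step (3 ^ n) c t" for t
  proof (cases "0 \<le> t \<and> t < 3 ^ n")
    case True
    then have "walsh 3 \<gamma> k t = \<gamma> ^ (\<Sum>i<n. \<kappa> i * ternary_digit (nat \<lfloor>t\<rfloor>) i)"
      using walsh_eq_digit_sum[OF k, of t n] by (simp add: \<kappa>_def)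
    then have "chirp \<gamma> (\<lambda>_. 0) n (nat \<lfloor>t\<rfloor>) * walsh 3 \<gamma> k t = chirp \<gamma> \<kappa> n (nat \<lfloor>t\<rfloor>)"
      unfolding chirp_def by (simp add: power_sum power_add prod.distrib)
    then show ?thesis using True by (simp add: F_def c_def unit_step_eq)
  qed (auto simp: F_def unit_step_eq)
  \<comment> \<open>The digit sum does not see the reversal of digits.\<close>
  have S: "(\<Sum>i<n. real (\<kappa> i) - 1) = S"
    unfolding S_def digit_deviation_def \<kappa>_def
    by (rule sum.nat_diff_reindex)
  have "ordered_pair_sum (3 ^ n) c = ordered_pair_sum (3 ^ n) (chirp \<gamma> \<kappa> n) / 3 ^ n"
  proof -
    have "of_real (sqrt (3 ^ n)) * of_real (sqrt (3 ^ n)) = (3 ^ n :: complex)"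
      by (simp flip: of_real_mult)
    then have "(\<Sum>l<m. c l) * cnj (c m) = (\<Sum>l<m. chirp \<gamma> \<kappa> n l) * cnj (chirp \<gamma> \<kappa> n m) / 3 ^ n" for m
      unfolding c_def by (simp flip: sum_divide_distrib)
    then show ?thesis by (simp add: ordered_pair_sum_def sum_divide_distrib)
  qed
  also have "\<dots> = (\<gamma> - \<gamma> ^ 2) / 3 * of_real S"
    using ordered_pair_sum_chirp[OF \<gamma>, of \<kappa> n] by (simp add: S[symmetric] \<kappa>_def ternary_digit_less)
  also have "\<dots> = (1 + 2 * \<gamma>) / 3 * of_real S"
    by (simp add: primitive_cube_root(3)[OF \<gamma>])
  finally have "Im (ordered_pair_sum (3 ^ n) c) = Im ((1 + 2 * \<gamma>) / 3 * of_real S)"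
    by (rule arg_cong)
  then have "Im (ordered_pair_sum (3 ^ n) c) = 2 / 3 * Im \<gamma> * S"
    by simp
  moreover have "Im D = Im (ordered_pair_sum (3 ^ n) c)"
    unfolding D_def Fw using Im_triangle_integral_unit_step[of "3 ^ n" c] by simp
  moreover have "3 / 4 \<le> \<bar>Im \<gamma>\<bar>"
  proof (rule power2_le_imp_le)
    show "(3 / 4)\<^sup>2 \<le> \<bar>Im \<gamma>\<bar>\<^sup>2"
      using primitive_cube_root(5)[OF \<gamma>] by (simp add: power2_eq_square)
  qed simp
  then have "3 / 4 * \<bar>S\<bar> \<le> \<bar>Im \<gamma>\<bar> * \<bar>S\<bar>" by (rule mult_right_mono) simp
  ultimately have "\<bar>S\<bar> / 2 \<le> \<bar>Im D\<bar>"
    by (simp add: abs_mult)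
  then have "\<bar>S\<bar> / 2 \<le> cmod D" using abs_Im_le_cmod[of D] by linarith
  moreover have "ereal (cmod D) \<le> maximal_fn 3 \<gamma> F k"
    unfolding maximal_fn_def D_def by (rule SUP_upper) simp
  ultimately show ?thesis unfolding S_def by (meson ereal_less_eq(3) order_trans)
qed

theorem proposition5p1:
  fixes \<gamma> :: complex
  assumes "primitive_root_of_unity 3 \<gamma>"
  shows "\<exists>\<epsilon>>(0::real). \<forall>N>(0::real). \<exists>F :: real \<Rightarrow> complex.
           adic_step_function 3 F \<and> L2_norm_nonneg F = 1 \<and>
           emeasure lebesgue {k. k \<ge> 0 \<and> maximal_fn 3 \<gamma> F k > ereal N} > ennreal \<epsilon>"
proof (intro exI[of _ "1 / 10"] conjI allI impI)
  fix N :: real assume "N > 0"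
  \<comment> \<open>The lower bound is half the deviation, so \<open>n / 3 \<ge> (2 * N)\<^sup>2\<close> is what is needed.\<close>
  define n where "n = nat \<lceil>12 * N\<^sup>2\<rceil>"
  have n: "n > 0" "12 * N\<^sup>2 \<le> real n" using \<open>N > 0\<close> by (auto simp: n_def)
  define F where "F = unit_step (3 ^ n) (\<lambda>m. chirp \<gamma> (\<lambda>_. 0) n m / sqrt (3 ^ n))"
  define A where "A = {k. 0 \<le> k \<and> maximal_fn 3 \<gamma> F k > ereal N}"
  define G where "G = {m. m < 3 ^ n \<and> digit_deviation n m ^ 2 > n / 3}"
  define J where "J m = {real m / 3 ^ n..<(real m + 1) / 3 ^ n}" for m
  have finG: "finite G" by (simp add: G_def)
  have J_iff: "k \<in> J m \<longleftrightarrow> 0 \<le> k \<and> m = nat \<lfloor>k * 3 ^ n\<rfloor>" for k m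
  proof -
    have "k \<in> J m \<longleftrightarrow> k * 3 ^ n \<in> {real m..<real m + 1}"
      by (simp add: J_def divide_le_eq less_divide_eq)
    moreover have "0 \<le> k * 3 ^ n \<longleftrightarrow> 0 \<le> k" using mult_le_cancel_right_pos[of "3 ^ n" 0 k] by simp
    ultimately show ?thesis by (simp only: in_unit_interval_iff)
  qed
  have "J m \<subseteq> A" if "m \<in> G" for m
  proof
    fix k assume "k \<in> J m"
    then have k: "0 \<le> k" "m = nat \<lfloor>k * 3 ^ n\<rfloor>" by (auto simp: J_iff)
    have "(real m + 1) / 3 ^ n \<le> 1"
    proof -
      have "Suc m \<le> 3 ^ n" using that by (simp add: G_def Suc_le_eq)
      then have "real (Suc m) \<le> 3 ^ n" by (metis of_nat_le_iff of_nat_numeral of_nat_power)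
      then show ?thesis by simp
    qed
    moreover have "k < (real m + 1) / 3 ^ n" using \<open>k \<in> J m\<close> by (simp add: J_def)
    ultimately have "k < 1" by linarith
    have "(2 * N)\<^sup>2 < \<bar>digit_deviation n m\<bar>\<^sup>2"
      using that n by (simp add: G_def power_mult_distrib)
    then have "2 * N < \<bar>digit_deviation n m\<bar>" by (rule power_less_imp_less_base) simp
    then have "ereal N < ereal (\<bar>digit_deviation n (nat \<lfloor>k * 3 ^ n\<rfloor>)\<bar> / 2)"
      using k by simp
    also have "\<dots> \<le> maximal_fn 3 \<gamma> F k"
      unfolding F_def by (rule maximal_fn_chirp_ge[OF assms k(1) \<open>k < 1\<close>])
    finally show "k \<in> A" using k by (simp add: A_def)
  qed
  then have "emeasure lebesgue (\<Union>m\<in>G. J m) \<le> emeasure lebesgue A"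
    unfolding A_def F_def by (intro emeasure_mono measurable_maximal_fn_superlevel) auto
  moreover have "emeasure lebesgue (\<Union>m\<in>G. J m) = ennreal (card G / 3 ^ n)"
  proof -
    have "emeasure lebesgue (J m) = ennreal (1 / 3 ^ n)" for m
      by (simp add: J_def divide_right_mono flip: diff_divide_distrib)
    moreover have "disjoint_family_on J G" by (auto simp: disjoint_family_on_def J_iff)
    moreover have "J ` G \<subseteq> sets lebesgue" by (auto simp: J_def)
    ultimately have "emeasure lebesgue (\<Union>m\<in>G. J m) = (\<Sum>m\<in>G. ennreal (1 / 3 ^ n))"
      using sum_emeasure[of J G lebesgue] finG by simp
    then show ?thesis by (simp add: ennreal_of_nat_eq_real_of_nat flip: ennreal_mult)
  qed
  moreover have "1 / 10 < card G / 3 ^ n"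
    using card_large_digit_deviation[OF n(1)] by (simp add: G_def field_simps)
  then have "ennreal (1 / 10) < ennreal (card G / 3 ^ n)" by (subst ennreal_less_iff) auto
  ultimately have "ennreal (1 / 10) < emeasure lebesgue A" by simp
  moreover have "L2_norm_nonneg F = 1"
  proof -
    have "cmod (chirp \<gamma> (\<lambda>_. 0) n m) = 1" for m
      by (simp add: chirp_def norm_power primitive_cube_root(2)[OF assms] flip: prod_norm)
    then show ?thesis
      by (simp add: F_def L2_norm_unit_step norm_divide power_divide)
  qed
  moreover have "adic_step_function 3 F"
    unfolding F_def by (rule adic_step_function_unit_step)
  ultimately show "\<exists>F :: real \<Rightarrow> complex.
           adic_step_function 3 F \<and> L2_norm_nonneg F = 1 \<and>
           emeasure lebesgue {k. k \<ge> 0 \<and> maximal_fn 3 \<gamma> F k > ereal N} > ennreal (1 / 10)"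
    unfolding A_def by blast
qed simp

end
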